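(* Let $2\le m_1\le\ldots\le m_k$ be integers with $n=m_1+\ldots+m_k\le 13$. Then $\mathrm{OP}^\ast(m_1,\ldots,m_k)$ has a solution if and only if $(m_1,\ldots,m_k)\notin\{(4),(6),(3,3)\}$.
   Context: $K_n^\ast$ is the complete symmetric digraph of order $n$. $\mathrm{OP}^\ast(m_1,\ldots,m_k)$ (with $n=m_1+\ldots+m_k$, all $m_i\ge 2$) asks for a decomposition of $K_n^\ast$ into spanning subdigraphs each a disjoint union of $k$ directed cycles of lengths $m_1,\ldots,m_k$; such a decomposition is a solution. *)

theory Defs
  imports "HOL-Library.Disjoint_Sets" "Graph_Theory.Graph_Theory"
begin

text \<open>The complete symmetric digraph of order \<open>n\<close>, on the vertex set \<open>{0, ..., n - 1}\<close>.\<close>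

definition complete_symmetric_digraph :: "nat \<Rightarrow> (nat, nat \<times> nat) pre_digraph" where
  "complete_symmetric_digraph n =
     with_proj \<lparr> pverts = {..<n}, parcs = {(u, v). u < n \<and> v < n \<and> u \<noteq> v} \<rparr>"

lemma complete_digraph_complete_symmetric_digraph:
  "complete_digraph n (complete_symmetric_digraph n)"
  unfolding complete_symmetric_digraph_def complete_digraph_pair_def by auto

text \<open>
  The digraph \<open>C\<close> is itself a directed cycle of length \<open>m\<close>: it has no arcs and no vertices
  besides those of the closed walk \<open>p\<close>. A directed cycle of length 2 consists of
  two opposite arcs.
\<close>

definition directed_cycle :: "nat \<Rightarrow> ('a, 'b) pre_digraph \<Rightarrow> bool" where
  "directed_cycle m C \<longleftrightarrow>
     (\<exists>p. pre_digraph.cycle C p \<and> length p = m \<and> arcs C = set p \<and> verts C = tail C ` set p)"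

definition disjoint_union_of_directed_cycles :: "nat list \<Rightarrow> ('a, 'b) pre_digraph \<Rightarrow> bool" where
  "disjoint_union_of_directed_cycles ms H \<longleftrightarrow>
     (\<exists>Cs. length Cs = length ms \<and>
        (\<forall>i < length ms. subgraph (Cs ! i) H \<and> directed_cycle (ms ! i) (Cs ! i)) \<and>
        disjoint_family_on (\<lambda>i. verts (Cs ! i)) {..<length ms} \<and>
        verts H = (\<Union>i < length ms. verts (Cs ! i)) \<and>
        arcs H = (\<Union>i < length ms. arcs (Cs ! i)))"

definition decomposition :: "('a, 'b) pre_digraph \<Rightarrow> ('a, 'b) pre_digraph set \<Rightarrow> bool" where
  "decomposition G Hs \<longleftrightarrow>
     (\<forall>H \<in> Hs. subgraph H G) \<and> disjoint_family_on arcs Hs \<and> (\<Union>H \<in> Hs. arcs H) = arcs G"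

definition directed_OP_solution :: "nat list \<Rightarrow> (nat, nat \<times> nat) pre_digraph set \<Rightarrow> bool" where
  "directed_OP_solution ms Hs \<longleftrightarrow>
     (let G = complete_symmetric_digraph (sum_list ms) in
       decomposition G Hs \<and>
       (\<forall>H \<in> Hs. spanning H G \<and> disjoint_union_of_directed_cycles ms H))"

end

theory Submission
  imports Defs
begin

text \<open>
  Solutions are given explicitly. Most of them are cyclic: with \<open>m = n - 1\<close>, the vertices are
  \<open>\<int>\<^sub>m \<union> {\<infinity>}\<close>, and a single base factor in which every nonzero difference modulo \<open>m\<close>
  occurs exactly once yields all factors by rotation. When the differences rule out a single base
  factor (for even \<open>n\<close> their sum is 0, which forces \<open>\<infinity>\<close> into a cycle of length 2), two or three
  base factors under a proper subgroup of the rotations may still exist; the remaining types are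
  listed in full.

  In the types (4), (6) and (3,3) all cycles have the same length, so a factor is a map all of whose
  orbits have that length. The \<open>n - 1\<close> factors are pairwise disjoint and are distinguished by
  the image of 0, which leaves a small search.
\<close>

subsection \<open>Directed cycles as lists of vertices\<close>

definition cycle_arcs :: "'a list \<Rightarrow> ('a \<times> 'a) list" where
  "cycle_arcs c = zip c (rotate1 c)"

lemma cycle_arcs_eq_Nil_iff [simp]: "cycle_arcs c = [] \<longleftrightarrow> c = []"
  by (cases c) (auto simp: cycle_arcs_def)

lemma map_fst_cycle_arcs [simp]: "map fst (cycle_arcs c) = c"
  and map_snd_cycle_arcs [simp]: "map snd (cycle_arcs c) = rotate1 c"
  and length_cycle_arcs [simp]: "length (cycle_arcs c) = length c"
  by (simp_all add: cycle_arcs_def)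

lemma in_set_cycle_arcs_iff:
  "(a, b) \<in> set (cycle_arcs c) \<longleftrightarrow>
     (\<exists>i < length c. a = c ! i \<and> b = c ! (Suc i mod length c))"
  by (auto simp: cycle_arcs_def set_zip nth_rotate1)

lemma fst_cycle_arcs: "fst ` set (cycle_arcs c) = set c"
  by (metis list.set_map map_fst_cycle_arcs)

lemma set_cycle_arcs_subset: "set (cycle_arcs c) \<subseteq> set c \<times> set c"
  by (metis cycle_arcs_def set_rotate1 set_zip_leftD set_zip_rightD subrelI SigmaI)

text \<open>Each arc starts where the previous one ends, so the heads with \<open>u\<close> in front
  are the tails with \<open>v\<close> behind. This turns the recursive walk predicate into one list
  equation.\<close>

lemma cas_fst_snd:
  assumes "tail C = fst" "head C = snd"
  shows "pre_digraph.cas C u p v \<longleftrightarrow> u # map snd p = map fst p @ [v]"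
proof (induction p arbitrary: u)
  case Nil
  show ?case by (auto simp: pre_digraph.cas.simps)
next
  case (Cons e es)
  then show ?case using assms by (auto simp: pre_digraph.cas.simps)
qed

text \<open>For a closed walk that equation makes the list of heads the list of tails rotated by
  one, so the tails determine the walk. A cycle has distinct heads, and the rotation carries this
  over to the tails.\<close>

lemma cycle_fst_snd:
  assumes "tail C = fst" "head C = snd"
  shows "pre_digraph.cycle C p \<longleftrightarrow>
    (\<exists>c. c \<noteq> [] \<and> distinct c \<and> p = cycle_arcs c \<and> hd c \<in> verts C \<and> set p \<subseteq> arcs C)"
    (is "?L \<longleftrightarrow> ?R")
proof
  assume ?L
  then obtain u where u: "u \<in> verts C" "set p \<subseteq> arcs C" "pre_digraph.cas C u p u"
    "distinct (tl (pre_digraph.awalk_verts C u p))" "p \<noteq> []"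
    by (auto simp: pre_digraph.cycle_def pre_digraph.awalk_def)
  have walk: "u # map snd p = map fst p @ [u]"
    using u(3) cas_fst_snd[OF assms] by blast
  with \<open>p \<noteq> []\<close> obtain c where c: "map fst p = u # c"
    by (cases p) auto
  have snd_p: "map snd p = rotate1 (u # c)"
    using walk c by simp
  have "p = cycle_arcs (u # c)"
    unfolding cycle_arcs_def using c snd_p by (metis zip_map_fst_snd)
  moreover have "tl (pre_digraph.awalk_verts C u p) = map snd p"
    using pre_digraph.awalk_verts_conv'[OF u(3)] u(5) assms by simp
  then have "distinct (u # c)"
    using u(4) snd_p by (metis distinct1_rotate)
  ultimately show ?R
    using u by (intro exI[of _ "u # c"]) auto
next
  assume ?R
  then obtain c where c: "c \<noteq> []" "distinct c" "p = cycle_arcs c" "hd c \<in> verts C" "set p \<subseteq> arcs C"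
    by blast
  have cas: "pre_digraph.cas C (hd c) p (hd c)"
    unfolding cas_fst_snd[OF assms] using c by (cases c) auto
  moreover have "tl (pre_digraph.awalk_verts C (hd c) p) = rotate1 c"
    using pre_digraph.awalk_verts_conv'[OF cas] c assms by simp
  ultimately show ?L
    using c by (auto simp: pre_digraph.cycle_def pre_digraph.awalk_def)
qed

lemma directed_cycle_fst_snd:
  assumes "tail C = fst" "head C = snd"
  shows "directed_cycle m C \<longleftrightarrow>
    (\<exists>c. c \<noteq> [] \<and> distinct c \<and> length c = m \<and> verts C = set c \<and> arcs C = set (cycle_arcs c))"
    (is "?L \<longleftrightarrow> ?R")
proof
  assume ?L
  then show ?R
    unfolding directed_cycle_def cycle_fst_snd[OF assms] assms
    using fst_cycle_arcs length_cycle_arcs by metis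
next
  assume ?R
  then obtain c where c: "c \<noteq> []" "distinct c" "length c = m" "verts C = set c"
    "arcs C = set (cycle_arcs c)"
    by blast
  then have "pre_digraph.cycle C (cycle_arcs c)"
    unfolding cycle_fst_snd[OF assms] by (intro exI[of _ c]) simp
  then show ?L
    unfolding directed_cycle_def assms
    using c by (intro exI[of _ "cycle_arcs c"]) (simp add: fst_cycle_arcs)
qed

subsection \<open>Solutions given by tables\<close>

definition factor_arcs :: "'a list list \<Rightarrow> ('a \<times> 'a) list" where
  "factor_arcs F = concat (map cycle_arcs F)"

text \<open>Equal arcs share their tail, so a repeated arc would repeat a head among the arcs with
  that tail.\<close>

lemma distinct_if_distinct_columns:
  assumes "\<And>u v. (u, v) \<in> set as \<Longrightarrow> distinct (map snd (filter (\<lambda>a. fst a = u) as))"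
  shows "distinct as"
  using assms
proof (induction as)
  case (Cons a as)
  have "distinct (map snd (filter (\<lambda>a. fst a = u) as))" if "(u, v) \<in> set as" for u v
    using Cons.prems[of u v] that by (auto split: if_splits)
  then have "distinct as"
    by (rule Cons.IH)
  moreover have "distinct (map snd (filter (\<lambda>b. fst b = fst a) (a # as)))"
    using Cons.prems[of "fst a" "snd a"] by simp
  then have "a \<notin> set as"
    by auto
  ultimately show ?case by simp
qed simp

text \<open>
  A table lists the factors as lists of vertex cycles. Counting the arcs replaces the test that
  every arc occurs. Since the tables are verified by rewriting, distinctness of the arcs is tested
  separately for each tail, where the quadratic test runs on short lists.
\<close>

definition arc_table :: "nat \<Rightarrow> (nat \<times> nat) list \<Rightarrow> bool" where
  "arc_table n as \<longleftrightarrow>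
     (\<forall>(u, v) \<in> set as. u < n \<and> v < n \<and> u \<noteq> v) \<and>
     (\<forall>u \<in> set [0..<n]. distinct (map snd (filter (\<lambda>a. fst a = u) as))) \<and>
     length as = n * (n - 1)"

definition solution_table :: "nat list \<Rightarrow> nat list list list \<Rightarrow> bool" where
  "solution_table ms Fs \<longleftrightarrow>
     (\<forall>F \<in> set Fs. map length F = ms \<and> distinct (concat F)) \<and>
     arc_table (sum_list ms) (concat (map factor_arcs Fs))"

lemma card_off_diagonal: "card {(u, v). u < n \<and> v < n \<and> u \<noteq> (v :: nat)} = n * (n - 1)"
proof -
  have "{(u, v). u < n \<and> v < n \<and> u \<noteq> v} = {..<n} \<times> {..<n} - (\<lambda>u. (u, u)) ` {..<n}"
    by auto
  moreover have "card \<dots> = n * n - n"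
    by (subst card_Diff_subset) (auto simp: card_image inj_on_def)
  ultimately show ?thesis
    by (simp add: diff_mult_distrib2)
qed

lemma map_fst_factor_arcs: "map fst (factor_arcs F) = concat F"
  by (simp add: factor_arcs_def map_concat comp_def)

lemma set_eq_nth_image: "set xs = (!) xs ` {..<length xs}"
  by (auto simp: set_conv_nth)

lemma set_factor_arcs: "set (factor_arcs F) = (\<Union>i<length F. set (cycle_arcs (F ! i)))"
  by (simp add: factor_arcs_def set_eq_nth_image[of F])

section \<open>From cycle lists to digraphs\<close>

lemma complete_symmetric_digraph_simps [simp]:
  "verts (complete_symmetric_digraph n) = {..<n}"
  "arcs (complete_symmetric_digraph n) = {(u, v). u < n \<and> v < n \<and> u \<noteq> v}"
  "tail (complete_symmetric_digraph n) = fst"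
  "head (complete_symmetric_digraph n) = snd"
  by (simp_all add: complete_symmetric_digraph_def)

lemma wf_digraph_with_proj: "wf_digraph (with_proj D) \<longleftrightarrow> parcs D \<subseteq> pverts D \<times> pverts D"
  unfolding wf_digraph_def by auto

lemma subgraph_with_proj:
  assumes "pverts D \<subseteq> pverts E" "parcs D \<subseteq> parcs E"
    "parcs D \<subseteq> pverts D \<times> pverts D" "parcs E \<subseteq> pverts E \<times> pverts E"
  shows "subgraph (with_proj D) (with_proj E)"
  using assms unfolding subgraph_def wf_digraph_with_proj compatible_def by simp

text \<open>The witnesses are the digraphs carried by the single lists. Distinctness of the
  concatenation gives both simple cycles and disjoint vertex sets.\<close>

lemma disjoint_union_of_cycle_lists:
  assumes "distinct (concat F)" "[] \<notin> set F"
  shows "disjoint_union_of_directed_cycles (map length F)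
    (with_proj \<lparr> pverts = set (concat F), parcs = set (factor_arcs F) \<rparr>)"
proof -
  define D where "D c = \<lparr> pverts = set c, parcs = set (cycle_arcs c) \<rparr>" for c :: "'a list"
  have cycles: "subgraph (with_proj (D (F ! i)))
        (with_proj \<lparr> pverts = set (concat F), parcs = set (factor_arcs F) \<rparr>)
      \<and> directed_cycle (length (F ! i)) (with_proj (D (F ! i)))" if i: "i < length F" for i
  proof
    have mem: "F ! i \<in> set F" using i by simp
    have "set (factor_arcs F) \<subseteq> set (concat F) \<times> set (concat F)"
      using set_cycle_arcs_subset by (fastforce simp: factor_arcs_def)
    moreover have "set (F ! i) \<subseteq> set (concat F)" "set (cycle_arcs (F ! i)) \<subseteq> set (factor_arcs F)"
      using mem by (auto simp: factor_arcs_def)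
    ultimately show "subgraph (with_proj (D (F ! i)))
        (with_proj \<lparr> pverts = set (concat F), parcs = set (factor_arcs F) \<rparr>)"
      using set_cycle_arcs_subset[of "F ! i"] unfolding D_def
      by (intro subgraph_with_proj) simp_all
    have "distinct (F ! i)" "F ! i \<noteq> []"
      using assms mem by (auto simp: distinct_concat_iff)
    then show "directed_cycle (length (F ! i)) (with_proj (D (F ! i)))"
      by (subst directed_cycle_fst_snd) (auto simp: D_def)
  qed
  have disj: "disjoint_family_on (\<lambda>i. set (F ! i)) {..<length F}"
    unfolding disjoint_family_on_def
  proof safe
    fix i j x
    assume ij: "i < length F" "j < length F" "i \<noteq> j" and x: "x \<in> set (F ! i)" "x \<in> set (F ! j)"
    \<comment> \<open>\<open>distinct_concat_iff\<close> separates unequal lists and makes the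
      nonempty ones distinct. Without empty lists, different indices give unequal lists.\<close>
    have "removeAll [] F = F"
      using assms(2) by simp
    then have "distinct F" and "set (F ! i) \<inter> set (F ! j) = {}"
      using assms(1) ij by (auto simp: distinct_concat_iff nth_eq_iff_index_eq)
    then show "x \<in> {}" using x by auto
  qed
  have "set (concat F) = (\<Union>i<length F. set (F ! i))"
    by (simp add: set_eq_nth_image[of F])
  with cycles disj show ?thesis
    unfolding disjoint_union_of_directed_cycles_def
    by (intro exI[of _ "map (\<lambda>c. with_proj (D c)) F"])
      (simp add: set_factor_arcs D_def disjoint_family_on_def)
qed

text \<open>The listed arcs are distinct, lie off the diagonal and number
  \<open>n * (n - 1)\<close>, so they are all arcs of the complete digraph. Their distinctness also
  makes the factors arc-disjoint.\<close>

lemma directed_OP_solution_if_table: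
  assumes table: "solution_table ms Fs" and pos: "0 \<notin> set ms"
  shows "\<exists>Hs. directed_OP_solution ms Hs"
proof -
  define n where "n = sum_list ms"
  define A where "A = concat (map factor_arcs Fs)"
  define H where "H F = with_proj \<lparr> pverts = {..<n}, parcs = set (factor_arcs F) \<rparr>" for F
  have lengths: "map length F = ms" and dist: "distinct (concat F)" if "F \<in> set Fs" for F
    using table that by (auto simp: solution_table_def)
  have A: "set A \<subseteq> {(u, v). u < n \<and> v < n \<and> u \<noteq> v}" "length A = n * (n - 1)"
    and columns: "\<And>u. u < n \<Longrightarrow> distinct (map snd (filter (\<lambda>a. fst a = u) A))"
    using table by (auto simp: solution_table_def arc_table_def A_def n_def)
  have "distinct A"
    using A(1) columns by (intro distinct_if_distinct_columns) blast
  have arcs_all: "set A = {(u, v). u < n \<and> v < n \<and> u \<noteq> v}"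
  proof (rule card_subset_eq[OF _ A(1)])
    show "finite {(u, v). u < n \<and> v < n \<and> u \<noteq> v}"
      by (rule finite_subset[of _ "{..<n} \<times> {..<n}"]) auto
    show "card (set A) = card {(u, v). u < n \<and> v < n \<and> u \<noteq> v}"
      using A(2) \<open>distinct A\<close> by (simp add: distinct_card card_off_diagonal)
  qed
  have sub: "set (factor_arcs F) \<subseteq> {(u, v). u < n \<and> v < n \<and> u \<noteq> v}" if "F \<in> set Fs" for F
    using A(1) that by (auto simp: A_def)
  \<comment> \<open>The \<open>n\<close> distinct tails of a factor are all below \<open>n\<close>,
    so they exhaust the vertices.\<close>
  have verts: "set (concat F) = {..<n}" if F: "F \<in> set Fs" for F
  proof (rule card_subset_eq)
    show "set (concat F) \<subseteq> {..<n}"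
      using sub[OF F] unfolding map_fst_factor_arcs[symmetric] by auto
    have "card (set (concat F)) = length (concat F)"
      using dist[OF F] by (rule distinct_card)
    then show "card (set (concat F)) = card {..<n}"
      using lengths[OF F] by (simp add: length_concat n_def)
  qed simp
  have span: "spanning (H F) (complete_symmetric_digraph n)" if F: "F \<in> set Fs" for F
    using sub[OF F] unfolding spanning_def H_def complete_symmetric_digraph_def
    by (auto intro!: subgraph_with_proj)
  have union: "disjoint_union_of_directed_cycles ms (H F)" if F: "F \<in> set Fs" for F
  proof -
    have "[] \<notin> set F"
      using pos lengths[OF F] by force
    then show ?thesis
      using disjoint_union_of_cycle_lists[OF dist[OF F]] lengths[OF F] verts[OF F]
      by (simp add: H_def)
  qed
  have "disjoint_family_on arcs (H ` set Fs)"
    unfolding disjoint_family_on_def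
  proof safe
    fix F F' u v
    assume FF': "F \<in> set Fs" "F' \<in> set Fs" "H F \<noteq> H F'" "(u, v) \<in> arcs (H F)" "(u, v) \<in> arcs (H F')"
    \<comment> \<open>Distinctness of \<open>A\<close> separates unequal arc lists, so unequal
      digraphs are first traced back to unequal lists.\<close>
    then have "factor_arcs F \<noteq> factor_arcs F'"
      by (auto simp: H_def)
    then have "set (factor_arcs F) \<inter> set (factor_arcs F') = {}"
      using \<open>distinct A\<close> FF' by (auto simp: A_def distinct_concat_iff)
    then show "(u, v) \<in> {}"
      using FF' by (auto simp: H_def)
  qed
  moreover have "(\<Union>K \<in> H ` set Fs. arcs K) = arcs (complete_symmetric_digraph n)"
    using arcs_all by (auto simp: A_def H_def)
  ultimately have "directed_OP_solution ms (H ` set Fs)"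
    using span union
    by (simp add: directed_OP_solution_def decomposition_def n_def spanning_def)
  then show ?thesis ..
qed

subsection \<open>Nonexistence by exhaustive search\<close>

text \<open>Each application of \<open>f\<close> moves one position along \<open>c\<close>, modulo
  the length, so a vertex first returns after exactly \<open>length c\<close> steps.\<close>

lemma cycle_arcs_successor:
  assumes "distinct c" "\<And>v w. v \<in> set c \<Longrightarrow> (v, w) \<in> set (cycle_arcs c) \<longleftrightarrow> w = f v" "v \<in> set c"
  shows "(f ^^ length c) v = v" and "0 < k \<Longrightarrow> k < length c \<Longrightarrow> (f ^^ k) v \<noteq> v"
proof -
  let ?m = "length c"
  obtain i where i: "i < ?m" "v = c ! i"
    using assms(3) by (auto simp: in_set_conv_nth)
  have "0 < ?m" using i by linarith
  have step: "f (c ! j) = c ! (Suc j mod ?m)" if "j < ?m" for j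
    using assms(2)[of "c ! j" "c ! (Suc j mod ?m)"] that by (auto simp: in_set_cycle_arcs_iff)
  have orbit: "(f ^^ k) v = c ! ((i + k) mod ?m)" for k
  proof (induction k)
    case (Suc k)
    then show ?case
      using step[of "(i + k) mod ?m"] \<open>0 < ?m\<close> by (simp add: mod_Suc_eq)
  qed (use i in simp)
  show "(f ^^ ?m) v = v"
    using orbit[of ?m] i by simp
  assume k: "0 < k" "k < ?m"
  have "(i + k) mod ?m \<noteq> i"
  proof (cases "i + k < ?m")
    case False
    \<comment> \<open>Both \<open>i\<close> and \<open>k\<close> are below the length, so the index
      wraps exactly once and lands below \<open>i\<close>.\<close>
    then have "(i + k) mod ?m = i + k - ?m"
      using i k by (simp add: mod_if)
    then show ?thesis using False k i by linarith
  qed (use k in simp)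
  then show "(f ^^ k) v \<noteq> v"
    using assms(1) i \<open>0 < ?m\<close> unfolding orbit by (simp add: nth_eq_iff_index_eq)
qed

text \<open>Each vertex lies on exactly one of the disjoint cycles and has a unique outgoing arc
  there, which defines \<open>f\<close>; its period under \<open>f\<close> is the length of that
  cycle.\<close>

lemma cycle_factor_successor:
  assumes "disjoint_union_of_directed_cycles ms H" "tail H = fst" "head H = snd"
  shows "\<exists>f. (\<forall>v w. (v, w) \<in> arcs H \<longleftrightarrow> v \<in> verts H \<and> w = f v) \<and>
    (\<forall>v \<in> verts H. \<exists>m \<in> set ms. (f ^^ m) v = v \<and> (\<forall>k. 0 < k \<and> k < m \<longrightarrow> (f ^^ k) v \<noteq> v))"
proof -
  obtain Cs where Cs: "length Cs = length ms"
      "\<And>i. i < length ms \<Longrightarrow> subgraph (Cs ! i) H \<and> directed_cycle (ms ! i) (Cs ! i)"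
      "disjoint_family_on (\<lambda>i. verts (Cs ! i)) {..<length ms}"
      "verts H = (\<Union>i < length ms. verts (Cs ! i))"
      "arcs H = (\<Union>i < length ms. arcs (Cs ! i))"
    using assms(1) unfolding disjoint_union_of_directed_cycles_def by blast
  have "\<exists>c. c \<noteq> [] \<and> distinct c \<and> length c = ms ! i \<and> verts (Cs ! i) = set c
      \<and> arcs (Cs ! i) = set (cycle_arcs c)" if "i < length ms" for i
  proof -
    have "tail (Cs ! i) = fst" "head (Cs ! i) = snd"
      using Cs(2)[OF that] assms(2,3) by (auto simp: subgraph_def compatible_def)
    then show ?thesis
      using Cs(2)[OF that] directed_cycle_fst_snd by blast
  qed
  then obtain c where c: "\<And>i. i < length ms \<Longrightarrow> distinct (c i) \<and> length (c i) = ms ! i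
      \<and> verts (Cs ! i) = set (c i) \<and> arcs (Cs ! i) = set (cycle_arcs (c i))"
    by metis
  define f where "f v = (THE w. (v, w) \<in> arcs H)" for v
  \<comment> \<open>An arc of another cycle with tail \<open>v\<close> would put \<open>v\<close>
    into two disjoint vertex sets.\<close>
  have local_arcs: "(v, w) \<in> arcs H \<longleftrightarrow> (v, w) \<in> set (cycle_arcs (c i))"
    if i: "i < length ms" "v \<in> set (c i)" for i v w
  proof
    assume "(v, w) \<in> arcs H"
    then obtain j where j: "j < length ms" "(v, w) \<in> set (cycle_arcs (c j))"
      using Cs(5) c by auto
    then have "v \<in> set (c j)"
      using set_cycle_arcs_subset by fastforce
    then have "i = j"
      using Cs(3) c i j(1) unfolding disjoint_family_on_def by blast
    then show "(v, w) \<in> set (cycle_arcs (c i))" using j(2) by simp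
  qed (use Cs(5) c i in auto)
  have succ: "(v, w) \<in> set (cycle_arcs (c i)) \<longleftrightarrow> w = f v"
    if i: "i < length ms" "v \<in> set (c i)" for i v w
  proof -
    obtain a where a: "a < length (c i)" "v = c i ! a"
      using i(2) by (auto simp: in_set_conv_nth)
    have iff: "(v, w) \<in> set (cycle_arcs (c i)) \<longleftrightarrow> w = c i ! (Suc a mod length (c i))" for w
      using a c[OF i(1)] by (auto simp: in_set_cycle_arcs_iff nth_eq_iff_index_eq)
    then have "f v = c i ! (Suc a mod length (c i))"
      unfolding f_def using local_arcs[OF i] by auto
    then show ?thesis using iff by simp
  qed
  show ?thesis
  proof (intro exI[of _ f] conjI allI ballI)
    fix v w
    show "(v, w) \<in> arcs H \<longleftrightarrow> v \<in> verts H \<and> w = f v"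
    proof (cases "v \<in> verts H")
      case True
      then obtain i where "i < length ms" "v \<in> set (c i)"
        using Cs(4) c by auto
      then show ?thesis using local_arcs succ True by simp
    next
      case False
      then show ?thesis
        using Cs(4,5) c set_cycle_arcs_subset by fastforce
    qed
  next
    fix v assume "v \<in> verts H"
    then obtain i where i: "i < length ms" "v \<in> set (c i)"
      using Cs(4) c by auto
    with cycle_arcs_successor[of "c i" f v] c[OF i(1)] succ[OF i(1)]
    show "\<exists>m \<in> set ms. (f ^^ m) v = v \<and> (\<forall>k. 0 < k \<and> k < m \<longrightarrow> (f ^^ k) v \<noteq> v)"
      by (intro bexI[of _ "ms ! i"]) auto
  qed
qed

section \<open>Enumeration of candidate factors and backtracking search\<close>

fun arrangements :: "nat \<Rightarrow> 'a list \<Rightarrow> 'a list list" where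
  "arrangements 0 xs = [[]]"
| "arrangements (Suc k) xs = concat (map (\<lambda>x. map ((#) x) (arrangements k (remove1 x xs))) xs)"

text \<open>A failed search refutes existence only if no candidate is missed; this guarantees it for
  the enumeration.\<close>

lemma in_arrangements:
  "distinct ys \<Longrightarrow> set ys \<subseteq> set xs \<Longrightarrow> ys \<in> set (arrangements (length ys) xs)"
proof (induction ys arbitrary: xs)
  case (Cons y ys)
  have "set ys \<subseteq> set (remove1 y xs)"
  proof
    fix x assume "x \<in> set ys"
    then show "x \<in> set (remove1 y xs)"
      using Cons.prems by (cases "x = y") auto
  qed
  with Cons show ?case by auto
qed simp

text \<open>
  A factor all of whose cycles have length \<open>m\<close> is encoded by the list of values of its successor
  map. In a solution there is exactly one factor whose successor map sends 0 to \<open>w\<close>, for each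
  \<open>w \<in> {1..<n}\<close>.
\<close>

definition uniform_rows :: "nat \<Rightarrow> nat \<Rightarrow> nat \<Rightarrow> nat list list" where
  "uniform_rows n m w =
     filter (\<lambda>r. list_all (\<lambda>v. (nth r ^^ m) v = v \<and> list_all (\<lambda>k. (nth r ^^ k) v \<noteq> v) [1..<m]) [0..<n])
       (map ((#) w) (arrangements (n - 1) (remove1 w [0..<n])))"

text \<open>Backtracking with forward pruning: choosing \<open>r\<close> leaves in the later lists
  only rows that differ from \<open>r\<close> in every position. For rows of successor values this
  means that the factors share no arc.\<close>

fun disjoint_choice :: "'a list list list \<Rightarrow> bool" where
  "disjoint_choice [] = True"
| "disjoint_choice (R # Rs) =
     list_ex (\<lambda>r. disjoint_choice (map (filter (list_all2 (\<noteq>) r)) Rs)) R"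

text \<open>Once \<open>g 0\<close> is chosen, no later \<open>g i\<close> is filtered out, so the
  selection shifted by one works for the remaining lists.\<close>

lemma disjoint_choiceI:
  assumes "\<And>i. i < length Rs \<Longrightarrow> g i \<in> set (Rs ! i)"
    and "\<And>i j. i < j \<Longrightarrow> j < length Rs \<Longrightarrow> list_all2 (\<noteq>) (g i) (g j)"
  shows "disjoint_choice Rs"
  using assms
proof (induction Rs arbitrary: g rule: disjoint_choice.induct)
  case (2 R Rs)
  have "disjoint_choice (map (filter (list_all2 (\<noteq>) (g 0))) Rs)"
  proof (rule "2.IH"[where g = "\<lambda>i. g (Suc i)"])
    show "g 0 \<in> set R" using "2.prems"(1)[of 0] by simp
  qed (use "2.prems"(1)[of "Suc _"] "2.prems"(2) in auto)
  then show ?case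
    using "2.prems"(1)[of 0] by (auto simp: list_ex_iff)
qed simp

text \<open>In a solution, let \<open>H w\<close> be a factor containing the arc from 0 to
  \<open>w\<close>, and \<open>f w\<close> its successor map. The value lists of these maps pass the
  orbit test and differ pairwise in every position, so the search would succeed.\<close>

lemma no_uniform_solution:
  assumes n: "n = sum_list ms" "0 < n" and uniform: "set ms = {m}" "0 < m"
    and search: "\<not> disjoint_choice (map (uniform_rows n m) [1..<n])"
  shows "\<nexists>Hs. directed_OP_solution ms Hs"
proof
  assume "\<exists>Hs. directed_OP_solution ms Hs"
  then obtain Hs where "directed_OP_solution ms Hs" by blast
  then have sub: "\<And>H. H \<in> Hs \<Longrightarrow> subgraph H (complete_symmetric_digraph n)"
    and disj: "disjoint_family_on arcs Hs"
    and union: "(\<Union>H \<in> Hs. arcs H) = {(u, v). u < n \<and> v < n \<and> u \<noteq> v}"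
    and verts: "\<And>H. H \<in> Hs \<Longrightarrow> verts H = {..<n}"
    and cyc: "\<And>H. H \<in> Hs \<Longrightarrow> disjoint_union_of_directed_cycles ms H"
    by (auto simp: directed_OP_solution_def decomposition_def spanning_def Let_def n(1))
  have "\<exists>H \<in> Hs. (0, w) \<in> arcs H" if "0 < w" "w < n" for w
  proof -
    have "(0, w) \<in> (\<Union>H \<in> Hs. arcs H)"
      unfolding union using that by auto
    then show ?thesis by blast
  qed
  then obtain H where H: "\<And>w. 0 < w \<Longrightarrow> w < n \<Longrightarrow> H w \<in> Hs \<and> (0, w) \<in> arcs (H w)"
    by metis
  have "\<exists>f. (\<forall>v u. (v, u) \<in> arcs (H w) \<longleftrightarrow> v < n \<and> u = f v) \<and>
      (\<forall>v < n. (f ^^ m) v = v \<and> (\<forall>k. 0 < k \<and> k < m \<longrightarrow> (f ^^ k) v \<noteq> v))" if w: "0 < w" "w < n" for w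
  proof -
    have mem: "H w \<in> Hs" using H[OF w] by blast
    have "tail (H w) = fst" "head (H w) = snd"
      using sub[OF mem] by (auto simp: subgraph_def compatible_def)
    then show ?thesis
      using cycle_factor_successor[OF cyc[OF mem]] verts[OF mem] uniform(1) by (simp add: Ball_def)
  qed
  then obtain f where arcs_f: "\<And>w v u. 0 < w \<Longrightarrow> w < n \<Longrightarrow> (v, u) \<in> arcs (H w) \<longleftrightarrow> v < n \<and> u = f w v"
    and order_f: "\<And>w v. 0 < w \<Longrightarrow> w < n \<Longrightarrow> v < n \<Longrightarrow>
      (f w ^^ m) v = v \<and> (\<forall>k. 0 < k \<and> k < m \<longrightarrow> (f w ^^ k) v \<noteq> v)"
    by metis
  have f_0: "f w 0 = w" if "0 < w" "w < n" for w
    using H[OF that] arcs_f[OF that] by simp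
  have f_less: "f w v < n" if w: "0 < w" "w < n" and "v < n" for w v
  proof -
    have "(v, f w v) \<in> (\<Union>H \<in> Hs. arcs H)"
      using H[OF w] arcs_f[OF w] \<open>v < n\<close> by blast
    then show ?thesis by (simp add: union)
  qed
  have f_neq: "f w v \<noteq> f w' v"
    if w: "0 < w" "w < n" and w': "0 < w'" "w' < n" and "w \<noteq> w'" "v < n" for w w' v
  proof
    assume eq: "f w v = f w' v"
    then have "(v, f w v) \<in> arcs (H w) \<inter> arcs (H w')"
      using arcs_f w w' \<open>v < n\<close> by simp
    \<comment> \<open>Distinct factors are arc-disjoint, so a common arc identifies the two; then 0
      would have both \<open>w\<close> and \<open>w'\<close> as successor in one factor.\<close>
    then have "H w = H w'"
      using disj H[OF w] H[OF w'] unfolding disjoint_family_on_def by blast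
    then have "w = f w' 0"
      using arcs_f[OF w'] H[OF w] by simp
    then show False using f_0[OF w'] \<open>w \<noteq> w'\<close> by simp
  qed
  define r where "r w = map (f w) [0..<n]" for w
  have "r w \<in> set (uniform_rows n m w)" if w: "0 < w" "w < n" for w
  proof -
    have upt: "[0..<n] = 0 # [1..<n]"
      using \<open>0 < n\<close> by (simp add: upt_conv_Cons)
    \<comment> \<open>The \<open>m\<close>-th iterate of \<open>f w\<close> is the identity on the
      vertices and \<open>m\<close> is positive, so equal values have equal arguments.\<close>
    have "inj_on (f w) {..<n}"
    proof (rule inj_onI)
      fix a b assume "a \<in> {..<n}" "b \<in> {..<n}" "f w a = f w b"
      moreover from \<open>f w a = f w b\<close> have "(f w ^^ m) a = (f w ^^ m) b"
        using \<open>0 < m\<close> by (cases m) (simp_all add: funpow_swap1)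
      ultimately show "a = b" using order_f[OF w] by simp
    qed
    then have "distinct (r w)"
      by (simp add: r_def distinct_map atLeast0LessThan)
    moreover have r_w: "r w = w # map (f w) [1..<n]"
      using f_0[OF w] by (simp add: r_def upt)
    moreover have "set (r w) \<subseteq> set [0..<n]"
      using f_less[OF w] by (auto simp: r_def)
    ultimately have arr: "map (f w) [1..<n] \<in> set (arrangements (n - 1) (remove1 w [0..<n]))"
      using in_arrangements[of "map (f w) [1..<n]" "remove1 w [0..<n]"] by auto
    \<comment> \<open>\<open>nth (r w)\<close> is known to agree with \<open>f w\<close> only below
      \<open>n\<close>, so the induction also carries that the iterates stay below
      \<open>n\<close>.\<close>
    have "(nth (r w) ^^ k) v = (f w ^^ k) v \<and> (f w ^^ k) v < n" if "v < n" for v k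
      by (induction k) (use that f_less[OF w] in \<open>auto simp: r_def\<close>)
    then show ?thesis
      using arr r_w order_f[OF w] by (auto simp: uniform_rows_def list_all_iff)
  qed
  moreover have "list_all2 (\<noteq>) (r w) (r w')" if "0 < w" "w < w'" "w' < n" for w w'
    using f_neq[of w w'] that by (auto simp: r_def list_all2_conv_all_nth)
  \<comment> \<open>Position \<open>i\<close> of \<open>[1..<n]\<close> holds \<open>Suc i\<close>,
    the image of 0.\<close>
  ultimately have "disjoint_choice (map (uniform_rows n m) [1..<n])"
    by (intro disjoint_choiceI[where g = "\<lambda>i. r (Suc i)"]) auto
  with search show False ..
qed

text \<open>For each image of 0 the orbit test leaves 2 rows for one 4-cycle and, in the next two
  lemmas, 24 rows for one 6-cycle and 8 for two 3-cycles.\<close>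

lemma no_solution_4: "\<nexists>Hs. directed_OP_solution [4] Hs"
proof (rule no_uniform_solution)
  show "\<not> disjoint_choice (map (uniform_rows 4 4) [1..<4])"
    by code_simp
qed simp_all

lemma no_solution_6: "\<nexists>Hs. directed_OP_solution [6] Hs"
proof (rule no_uniform_solution)
  show "\<not> disjoint_choice (map (uniform_rows 6 6) [1..<6])"
    by code_simp
qed simp_all

lemma no_solution_3_3: "\<nexists>Hs. directed_OP_solution [3, 3] Hs"
proof (rule no_uniform_solution)
  show "\<not> disjoint_choice (map (uniform_rows 6 3) [1..<6])"
    by code_simp
qed simp_all

subsection \<open>The solutions\<close>

definition shift :: "nat \<Rightarrow> nat \<Rightarrow> nat \<Rightarrow> nat" where
  "shift m d v = (if v < m then (v + d) mod m else v)"

text \<open>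
  The vertex \<open>m\<close> is the fixed point of the rotation. With \<open>s\<close> base factors, each is rotated by
  the multiples of \<open>s\<close> only.
\<close>

definition rotations :: "nat list list list \<Rightarrow> nat list list list" where
  "rotations Fs = (let s = length Fs; m = length (concat (hd Fs)) - 1 in
     concat (map (\<lambda>i. map (map (map (shift m (s * i)))) Fs) [0..<m div s]))"

text \<open>Cycles are ordered by length, so that the types come out sorted. Closed cycles avoiding
  the fixed vertex \<open>m\<close> have difference sum 0. Hence in a single base factor the path
  left by removing \<open>m\<close> from its cycle has as difference sum that of all nonzero
  residues: \<open>m div 2\<close> for even \<open>m\<close>, 0 for odd \<open>m\<close>. Started at
  0, the cycle through \<open>m\<close> is therefore \<open>[m, 0, ..., m div 2]\<close> or
  \<open>[m, 0]\<close>.\<close>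

definition rotational_base_factors :: "nat list list list list" where
  "rotational_base_factors =
    [[[[1, 0]]],
     [[[2, 0, 1]]],
     [[[3, 0], [1, 2]]],
     [[[0, 4], [1, 2, 3]], [[3, 4], [0, 2, 1]]],
     [[[4, 0, 3, 1, 2]]],
     [[[5, 0], [1, 4], [2, 3]]],
     [[[5, 0], [1, 2, 4, 3]]],
     [[[0, 2], [3, 5], [1, 4, 6]], [[1, 2], [4, 5], [0, 3, 6]]],
     [[[0, 2], [1, 4, 3, 5, 6]], [[0, 1], [2, 5, 3, 4, 6]]],
     [[[2, 5, 4], [6, 0, 1, 3]]],
     [[[6, 0, 1, 5, 2, 4, 3]]],
     [[[7, 0], [1, 5], [2, 3], [4, 6]]],
     [[[7, 0], [1, 2, 4], [3, 6, 5]]],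
     [[[7, 0], [1, 5, 3, 4, 6, 2]]],
     [[[1, 6], [2, 3], [5, 7], [8, 0, 4]]],
     [[[0, 7], [4, 5], [1, 3, 8, 2, 6]], [[2, 7], [4, 6], [0, 8, 1, 5, 3]]],
     [[[1, 7], [8, 0, 4], [2, 3, 6, 5]]],
     [[[1, 2], [8, 0, 5, 7, 3, 6, 4]]],
     [[[8, 0, 4], [1, 6, 7], [2, 5, 3]]],
     [[[8, 0, 4], [1, 6, 5, 7, 2, 3]]],
     [[[1, 3, 7, 2], [8, 0, 5, 6, 4]]],
     [[[8, 0, 5, 6, 1, 7, 3, 2, 4]]],
     [[[9, 0], [1, 6], [2, 8], [3, 4], [5, 7]]],
     [[[9, 0], [1, 3], [2, 6], [4, 7, 8, 5]]],
     [[[9, 0], [1, 8], [2, 5, 6], [3, 7, 4]]],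
     [[[9, 0], [1, 6], [2, 3, 5, 8, 7, 4]]],
     [[[9, 0], [1, 6, 7], [2, 4, 8, 5, 3]]],
     [[[9, 0], [1, 6, 8, 2], [3, 7, 4, 5]]],
     [[[9, 0], [1, 6, 7, 5, 8, 3, 2, 4]]],
     [[[0, 8, 9], [1, 5, 3], [2, 4, 7, 6]], [[1, 8, 2], [3, 6, 7], [0, 9, 4, 5]],
      [[2, 7, 9], [5, 6, 8], [0, 4, 1, 3]]],
     [[[0, 8, 9], [1, 7, 5, 3, 4, 6, 2]], [[0, 7, 1], [2, 3, 6, 9, 8, 4, 5]],
      [[1, 5, 8], [0, 2, 6, 3, 7, 9, 4]]],
     [[[0, 8, 9, 7], [1, 5, 3, 4, 2, 6]], [[0, 7, 1, 6], [2, 3, 5, 4, 9, 8]],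
      [[1, 2, 8, 4], [0, 5, 7, 6, 9, 3]]],
     [[[0, 1, 8, 9, 7], [2, 5, 4, 3, 6]], [[0, 7, 9, 3, 2], [1, 4, 8, 5, 6]],
      [[0, 6, 9, 2, 4], [1, 7, 8, 3, 5]]],
     [[[0, 1, 8, 9, 7, 6, 3, 2, 4, 5]], [[0, 4, 7, 9, 3, 5, 1, 6, 2, 8]],
      [[0, 3, 1, 5, 8, 7, 4, 6, 9, 2]]],
     [[[1, 7], [2, 9], [3, 4], [6, 8], [10, 0, 5]]],
     [[[0, 6], [2, 9], [4, 10], [1, 5, 7, 3, 8]], [[0, 2], [3, 4], [5, 10], [1, 8, 9, 7, 6]]],
     [[[1, 9], [2, 8], [10, 0, 5], [3, 6, 7, 4]]],
     [[[3, 9], [4, 6], [10, 0, 1, 8, 7, 2, 5]]],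
     [[[1, 9], [10, 0, 5], [2, 3, 6], [4, 8, 7]]],
     [[[1, 4], [10, 0, 5], [2, 6, 8, 9, 7, 3]]],
     [[[3, 6], [10, 0, 1, 5], [2, 7, 9, 8, 4]]],
     [[[2, 4], [10, 0, 1, 8, 3, 7, 6, 9, 5]]],
     [[[10, 0, 5], [1, 8, 9], [2, 6, 4, 7, 3]]],
     [[[10, 0, 5], [1, 8, 9, 3], [2, 4, 7, 6]]],
     [[[10, 0, 5], [1, 3, 9, 6, 4, 7, 8, 2]]],
     [[[2, 6, 9, 7], [10, 0, 1, 8, 4, 3, 5]]],
     [[[10, 0, 1, 9, 5], [2, 4, 7, 6, 3, 8]]],
     [[[10, 0, 1, 8, 2, 4, 9, 7, 3, 6, 5]]],
     [[[11, 0], [1, 2], [3, 6], [4, 8], [5, 10], [7, 9]]],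
     [[[11, 0], [1, 2], [4, 7], [6, 8], [3, 9, 5, 10]]],
     [[[11, 0], [1, 2], [3, 7], [4, 6, 9], [5, 10, 8]]],
     [[[11, 0], [1, 2], [3, 9], [4, 8, 5, 7, 10, 6]]],
     [[[11, 0], [1, 3], [4, 8, 9], [2, 5, 10, 7, 6]]],
     [[[11, 0], [1, 2], [3, 6, 10, 8], [4, 9, 5, 7]]],
     [[[11, 0], [1, 2], [3, 6, 8, 4, 10, 7, 5, 9]]],
     [[[11, 0], [1, 2, 8], [3, 6, 4], [5, 10, 7, 9]]],
     [[[11, 0], [1, 2, 6], [3, 10, 4, 7, 9, 8, 5]]],
     [[[11, 0], [1, 2, 6, 4], [3, 10, 5, 8, 7, 9]]],
     [[[11, 0], [1, 2, 6, 8, 5], [3, 9, 7, 10, 4]]],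
     [[[11, 0], [1, 2, 6, 8, 5, 10, 9, 4, 7, 3]]],
     [[[0, 7], [1, 9], [2, 11], [5, 12], [6, 8], [3, 10, 4]],
      [[1, 3], [2, 10], [4, 7], [6, 12], [8, 9], [0, 5, 11]]],
     [[[2, 4], [3, 10], [5, 9], [8, 11], [12, 0, 1, 7, 6]]],
     [[[1, 8], [3, 11], [9, 10], [12, 0, 6], [2, 4, 7, 5]]],
     [[[2, 11], [3, 8], [7, 9], [12, 0, 1, 5, 4, 10, 6]]],
     [[[1, 3], [2, 9], [12, 0, 6], [4, 5, 8], [7, 11, 10]]],
     [[[1, 2], [3, 10], [12, 0, 6], [4, 8, 11, 9, 5, 7]]],
     [[[2, 10], [4, 7], [12, 0, 1, 6], [3, 5, 11, 9, 8]]],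
     [[[3, 11], [5, 10], [12, 0, 1, 4, 2, 8, 7, 9, 6]]],
     [[[1, 8], [12, 0, 6], [2, 10, 11], [3, 5, 9, 7, 4]]],
     [[[1, 2], [12, 0, 6], [3, 7, 10, 5], [4, 9, 11, 8]]],
     [[[1, 2], [12, 0, 6], [3, 7, 4, 11, 9, 5, 8, 10]]],
     [[[2, 10], [12, 0, 1, 6], [3, 5, 8, 7, 4, 11, 9]]],
     [[[2, 7], [12, 0, 1, 4, 6], [3, 11, 10, 8, 5, 9]]],
     [[[7, 11], [12, 0, 1, 4, 2, 8, 3, 5, 10, 9, 6]]],
     [[[12, 0, 6], [1, 8, 9], [3, 11, 10], [2, 4, 7, 5]]],
     [[[12, 0, 6], [1, 8, 4], [2, 3, 5, 10, 9, 7, 11]]],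
     [[[12, 0, 6], [1, 9, 8, 11], [2, 7, 4, 5, 3, 10]]],
     [[[12, 0, 6], [1, 2, 4, 11, 8], [3, 7, 10, 9, 5]]],
     [[[12, 0, 6], [1, 4, 8, 5, 3, 10, 11, 7, 9, 2]]],
     [[[12, 0, 1, 6], [2, 4, 11, 8], [3, 7, 10, 9, 5]]],
     [[[12, 0, 1, 6], [2, 8, 4, 3, 10, 7, 5, 9, 11]]],
     [[[12, 0, 1, 4, 6], [2, 7, 11, 10, 8, 3, 9, 5]]],
     [[[12, 0, 1, 4, 2, 6], [3, 11, 5, 10, 7, 9, 8]]],
     [[[12, 0, 1, 4, 2, 7, 9, 8, 5, 11, 3, 10, 6]]]]"

text \<open>All types here have order 8 or 12, where the rotations form a group of prime order 7 or
  11 whose only proper subgroup is trivial. Except for (2,2,4) they have no part 2, which excludes a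
  single base factor.\<close>

definition sporadic_solutions :: "nat list list list list" where
  "sporadic_solutions =
    [[[[0, 2], [3, 6], [1, 4, 7, 5]], [[1, 7], [5, 6], [0, 4, 2, 3]],
      [[0, 5], [1, 6], [2, 4, 3, 7]], [[0, 7], [2, 6], [1, 5, 3, 4]],
      [[0, 6], [1, 3], [2, 7, 4, 5]], [[0, 1], [4, 6], [2, 5, 7, 3]],
      [[1, 2], [6, 7], [0, 3, 5, 4]]],
     [[[3, 6, 5], [0, 7, 1, 4, 2]], [[1, 6, 3], [0, 2, 7, 5, 4]], [[0, 1, 5], [2, 4, 3, 7, 6]],
      [[0, 5, 6], [1, 3, 4, 7, 2]], [[4, 5, 7], [0, 3, 2, 6, 1]], [[2, 3, 5], [0, 6, 4, 1, 7]],
      [[1, 2, 5], [0, 4, 6, 7, 3]]],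
     [[[0, 4, 5, 3], [1, 6, 7, 2]], [[0, 6, 1, 7], [2, 5, 4, 3]], [[0, 7, 5, 1], [2, 3, 6, 4]],
      [[0, 5, 6, 2], [1, 3, 7, 4]], [[0, 2, 6, 5], [1, 4, 7, 3]], [[0, 1, 2, 4], [3, 5, 7, 6]],
      [[0, 3, 4, 6], [1, 5, 2, 7]]],
     [[[0, 7, 3, 5, 6, 4, 1, 2]], [[0, 1, 5, 4, 3, 2, 6, 7]], [[0, 2, 3, 1, 4, 5, 7, 6]],
      [[0, 3, 4, 6, 1, 7, 2, 5]], [[0, 6, 5, 2, 1, 3, 7, 4]], [[0, 4, 2, 7, 5, 1, 6, 3]],
      [[0, 5, 3, 6, 2, 4, 7, 1]]],
     [[[0, 1, 9], [2, 3, 6], [4, 8, 5], [7, 10, 11]],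
      [[0, 10, 8], [1, 3, 9], [2, 7, 5], [4, 6, 11]],
      [[0, 2, 6], [1, 7, 3], [4, 5, 10], [8, 9, 11]],
      [[1, 2, 10], [0, 4, 7], [5, 6, 3], [8, 11, 9]],
      [[1, 11, 6], [2, 4, 10], [0, 8, 3], [5, 7, 9]],
      [[1, 0, 7], [2, 8, 4], [5, 3, 11], [6, 10, 9]],
      [[2, 0, 11], [1, 5, 8], [3, 7, 4], [6, 9, 10]],
      [[2, 9, 7], [0, 5, 11], [1, 6, 4], [3, 8, 10]],
      [[2, 1, 8], [0, 6, 5], [3, 4, 9], [7, 11, 10]],
      [[0, 3, 10], [1, 4, 11], [2, 5, 9], [6, 7, 8]],
      [[9, 4, 0], [10, 5, 1], [11, 3, 2], [8, 7, 6]]],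
     [[[0, 3, 10], [2, 8, 11], [1, 5, 7, 9, 4, 6]], [[0, 8, 2], [4, 5, 11], [1, 9, 10, 6, 3, 7]],
      [[1, 3, 11], [4, 7, 10], [0, 9, 2, 5, 8, 6]], [[2, 6, 4], [5, 10, 7], [0, 11, 9, 8, 3, 1]],
      [[1, 7, 8], [6, 10, 9], [0, 2, 3, 4, 11, 5]], [[1, 11, 10], [5, 6, 9], [0, 7, 2, 4, 3, 8]],
      [[0, 4, 9], [2, 10, 3], [1, 6, 7, 11, 8, 5]], [[0, 1, 4], [3, 9, 7], [2, 11, 6, 8, 10, 5]],
      [[1, 2, 9], [4, 10, 8], [0, 5, 3, 6, 11, 7]], [[0, 10, 11], [2, 7, 6], [1, 8, 9, 3, 5, 4]],
      [[1, 10, 2], [4, 8, 7], [0, 6, 5, 9, 11, 3]]],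
     [[[1, 11, 10], [0, 6, 8, 7], [2, 5, 4, 9, 3]], [[1, 5, 11], [2, 10, 3, 8], [0, 7, 9, 6, 4]],
      [[0, 10, 6], [5, 7, 8, 9], [1, 4, 2, 11, 3]], [[2, 6, 5], [1, 10, 9, 7], [0, 8, 4, 3, 11]],
      [[0, 1, 8], [3, 9, 10, 5], [2, 4, 7, 6, 11]], [[3, 5, 8], [0, 4, 11, 9], [1, 6, 10, 7, 2]],
      [[6, 9, 11], [1, 3, 7, 4], [0, 2, 8, 5, 10]], [[1, 9, 8], [0, 11, 7, 5], [2, 3, 10, 4, 6]],
      [[1, 2, 9], [4, 10, 8, 11], [0, 5, 6, 7, 3]], [[0, 9, 2], [3, 4, 8, 6], [1, 7, 10, 11, 5]],
      [[4, 5, 9], [0, 3, 6, 1], [2, 7, 11, 8, 10]]],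
     [[[0, 3, 11], [1, 9, 5, 6, 7, 8, 4, 2, 10]], [[3, 9, 4], [0, 10, 6, 2, 1, 11, 8, 5, 7]],
      [[0, 11, 5], [1, 7, 3, 4, 6, 10, 2, 9, 8]], [[4, 11, 7], [0, 8, 3, 5, 2, 6, 1, 10, 9]],
      [[4, 10, 5], [0, 9, 7, 11, 1, 6, 3, 2, 8]], [[0, 7, 2], [1, 3, 6, 8, 11, 9, 10, 4, 5]],
      [[2, 4, 9], [0, 1, 8, 10, 7, 6, 5, 11, 3]], [[1, 5, 3], [0, 2, 7, 9, 11, 10, 8, 6, 4]],
      [[5, 8, 7], [0, 4, 1, 2, 11, 6, 9, 3, 10]], [[3, 7, 10], [0, 6, 11, 4, 8, 2, 5, 9, 1]],
      [[1, 4, 7], [0, 5, 10, 11, 2, 3, 8, 9, 6]]],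
     [[[0, 3, 4, 2], [1, 5, 6, 9], [7, 11, 10, 8]], [[0, 2, 7, 8], [1, 9, 5, 11], [3, 10, 4, 6]],
      [[0, 5, 4, 9], [1, 10, 11, 7], [2, 8, 3, 6]], [[1, 4, 5, 0], [2, 3, 7, 10], [8, 9, 11, 6]],
      [[1, 0, 8, 6], [2, 10, 3, 9], [4, 11, 5, 7]], [[1, 3, 5, 10], [2, 11, 9, 8], [0, 6, 4, 7]],
      [[2, 5, 3, 1], [0, 4, 8, 11], [6, 10, 9, 7]], [[2, 1, 6, 7], [0, 11, 4, 10], [5, 9, 3, 8]],
      [[2, 4, 3, 11], [0, 9, 10, 6], [1, 7, 5, 8]], [[3, 2, 6, 11], [4, 0, 7, 9], [5, 1, 8, 10]],
      [[3, 0, 10, 7], [4, 1, 11, 8], [5, 2, 9, 6]]],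
     [[[1, 5, 6, 2], [0, 11, 3, 9, 10, 7, 4, 8]], [[1, 2, 5, 10], [0, 9, 11, 6, 8, 4, 3, 7]],
      [[2, 8, 10, 11], [0, 5, 9, 6, 7, 3, 1, 4]], [[0, 6, 9, 5], [1, 8, 2, 3, 11, 10, 4, 7]],
      [[1, 9, 3, 4], [0, 2, 11, 8, 6, 5, 7, 10]], [[0, 3, 10, 2], [1, 7, 6, 4, 9, 8, 5, 11]],
      [[1, 11, 7, 5], [0, 4, 10, 8, 9, 2, 6, 3]], [[3, 6, 10, 5], [0, 8, 7, 2, 4, 11, 9, 1]],
      [[1, 10, 3, 8], [0, 7, 11, 5, 2, 9, 4, 6]], [[0, 1, 6, 11], [2, 10, 9, 7, 8, 3, 5, 4]],
      [[4, 5, 8, 11], [0, 10, 6, 1, 3, 2, 7, 9]]],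
     [[[2, 11, 7, 10, 3], [0, 6, 4, 1, 5, 9, 8]], [[0, 5, 10, 1, 3], [2, 4, 6, 11, 9, 7, 8]],
      [[0, 1, 8, 3, 9], [2, 10, 7, 4, 11, 6, 5]], [[0, 9, 4, 5, 6], [1, 7, 3, 8, 10, 11, 2]],
      [[1, 10, 9, 2, 6], [0, 11, 5, 3, 4, 8, 7]], [[1, 11, 8, 9, 5], [0, 2, 3, 7, 6, 10, 4]],
      [[0, 10, 6, 8, 11], [1, 2, 7, 5, 4, 9, 3]], [[2, 5, 8, 4, 10], [0, 7, 11, 3, 6, 9, 1]],
      [[0, 4, 3, 11, 10], [1, 9, 6, 2, 8, 5, 7]], [[6, 7, 9, 10, 8], [0, 3, 5, 11, 1, 4, 2]],
      [[2, 9, 11, 4, 7], [0, 8, 1, 6, 3, 10, 5]]],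
     [[[0, 10, 6, 1, 4, 5], [2, 7, 8, 3, 11, 9]], [[0, 2, 6, 7, 11, 1], [3, 10, 5, 9, 8, 4]],
      [[0, 7, 6, 5, 4, 2], [1, 9, 11, 8, 10, 3]], [[0, 6, 3, 4, 10, 11], [1, 2, 5, 8, 9, 7]],
      [[0, 5, 3, 2, 10, 7], [1, 6, 8, 11, 4, 9]], [[0, 11, 2, 8, 7, 3], [1, 5, 6, 10, 9, 4]],
      [[0, 3, 8, 1, 10, 4], [2, 9, 6, 11, 5, 7]], [[0, 8, 5, 1, 7, 9], [2, 3, 6, 4, 11, 10]],
      [[0, 9, 3, 5, 11, 6], [1, 8, 2, 4, 7, 10]], [[0, 1, 3, 9, 5, 10], [2, 11, 7, 4, 8, 6]],
      [[0, 4, 6, 9, 10, 8], [1, 11, 3, 7, 5, 2]]],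
     [[[0, 9, 2, 6, 11, 1, 8, 3, 4, 7, 10, 5]], [[0, 2, 4, 8, 10, 7, 5, 1, 3, 11, 9, 6]],
      [[0, 1, 5, 3, 6, 7, 9, 4, 2, 8, 11, 10]], [[0, 4, 10, 6, 2, 1, 9, 3, 5, 11, 8, 7]],
      [[0, 7, 8, 6, 4, 5, 10, 9, 1, 11, 2, 3]], [[0, 10, 3, 7, 11, 5, 9, 8, 4, 6, 1, 2]],
      [[0, 11, 3, 9, 5, 7, 2, 10, 4, 1, 6, 8]], [[0, 6, 3, 2, 5, 8, 1, 7, 4, 9, 10, 11]],
      [[0, 3, 8, 5, 6, 9, 7, 1, 10, 2, 11, 4]], [[0, 8, 2, 9, 11, 7, 6, 5, 4, 3, 10, 1]],
      [[0, 5, 2, 7, 3, 1, 4, 11, 6, 10, 8, 9]]]]"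

text \<open>The first base factor supplies the type; the table test then demands the same lengths in
  the same order from every factor.\<close>

lemma rotational_solution_tables:
  "list_all (\<lambda>Fs. solution_table (map length (hd Fs)) (rotations Fs)) rotational_base_factors"
  by code_simp

lemma sporadic_solution_tables:
  "list_all (\<lambda>Fs. solution_table (map length (hd Fs)) Fs) sporadic_solutions"
  by code_simp

section \<open>Completeness of the list of types\<close>

text \<open>Here \<open>k\<close> bounds the number of parts, \<open>b\<close> the parts from below and \<open>s\<close> their sum.\<close>

fun bounded_partitions :: "nat \<Rightarrow> nat \<Rightarrow> nat \<Rightarrow> nat list list" where
  "bounded_partitions 0 b s = [[]]"
| "bounded_partitions (Suc k) b s =
     [] # concat (map (\<lambda>m. map ((#) m) (bounded_partitions k m (s - m))) [b..<Suc s])"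

text \<open>Sortedness makes each part a lower bound for those after it, and the remaining sum drops
  by that part.\<close>

lemma in_bounded_partitions:
  assumes "sorted ms" "\<forall>m \<in> set ms. b \<le> m" "sum_list ms \<le> s" "length ms \<le> k"
  shows "ms \<in> set (bounded_partitions k b s)"
  using assms
proof (induction k arbitrary: ms b s)
  case (Suc k)
  show ?case
  proof (cases ms)
    case (Cons m ms')
    then have "ms' \<in> set (bounded_partitions k m (s - m))"
      using Suc by simp
    then show ?thesis
      using Cons Suc.prems(2,3) by (auto simp del: upt_Suc)
  qed simp
qed simp

text \<open>Bounding the sum instead of fixing it treats all orders up to 13 in one evaluation and
  lets the empty list in. At most 6 parts of size at least 2 fit into 13.\<close>

lemma covered_partitions:
  "list_all (\<lambda>ms. ms \<in> set ([[], [4], [6], [3, 3]]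
       @ map (\<lambda>Fs. map length (hd Fs)) (rotational_base_factors @ sporadic_solutions)))
     (bounded_partitions 6 2 13)"
  by code_simp

lemma length_le_half_sum_list:
  "\<forall>m \<in> set ms. 2 \<le> m \<Longrightarrow> 2 * length ms \<le> sum_list (ms :: nat list)"
  by (induction ms) auto

theorem theorem9p1:
  fixes ms :: "nat list"
  assumes "ms \<noteq> []"
    and "sorted ms"
    and "\<forall>m \<in> set ms. 2 \<le> m"
    and "sum_list ms \<le> 13"
  shows "(\<exists>Hs. directed_OP_solution ms Hs) \<longleftrightarrow> ms \<notin> {[4], [6], [3, 3]}"
proof
  assume "\<exists>Hs. directed_OP_solution ms Hs"
  then show "ms \<notin> {[4], [6], [3, 3]}"
    using no_solution_4 no_solution_6 no_solution_3_3 by blast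
next
  assume exception: "ms \<notin> {[4], [6], [3, 3]}"
  have "length ms \<le> 6"
    using length_le_half_sum_list[OF assms(3)] assms(4) by linarith
  with assms have "ms \<in> set (bounded_partitions 6 2 13)"
    by (intro in_bounded_partitions) auto
  with covered_partitions exception \<open>ms \<noteq> []\<close>
  have "ms \<in> (\<lambda>Fs. map length (hd Fs)) ` (set rotational_base_factors \<union> set sporadic_solutions)"
    unfolding list_all_iff by auto
  then obtain Fs where "solution_table ms Fs"
    using rotational_solution_tables sporadic_solution_tables unfolding list_all_iff by blast
  then show "\<exists>Hs. directed_OP_solution ms Hs"
    by (rule directed_OP_solution_if_table) (use assms(3) in force)
qed

end
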